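(* Suppose that steepest descent in the norm $\|\cdot\|$ is applied to the logistic loss $L_n(\cdot)$, initialized at $\beta^0:=0$, with the step-size sequence $\alpha_k := \frac{4n\|\nabla L_n(\beta^k)\|_*}{\|\mathbf{X}\|_{\cdot,2}^2}$ for all $k\ge0$. Suppose that the data is non-separable and $\mathrm{DegNSEP}^*>0$, and let $\beta^*$ be the unique minimizer of $L_n$. Define $$\tau_{\mathrm{slow}} := 1-\frac{2(\mathrm{DegNSEP}^* )\,\nu^*(H(\beta^* ))\,n}{(\mathrm{DegNSEP}^*+2\ln(2)\|\mathbf{X}\|_{\cdot,\infty})\|\mathbf{X}\|_{\cdot,2}^2} .$$ Then $\tau_{\mathrm{slow}}<1$, and for all $k\ge0$: (i) $L_n(\beta^k)-L_n^* \le (\ln(2)-L_n^* )\cdot(\tau_{\mathrm{slow}})^k$, and (ii) $\|\beta^k-\beta^*\| \le \Big(1+\frac{2\ln(2)\|\mathbf{X}\|_{\cdot,\infty}}{\mathrm{DegNSEP}^*}\Big)\Big(\frac{\|\mathbf{X}\|_{\cdot,2}}{\nu^*(H(\beta^* ))}\Big)\sqrt{\frac{\ln(2)-L_n^*}{2n}}\cdot(\tau_{\mathrm{slow}})^{k/2}$. Furthermore, define $$\check K := \left\lceil\frac{16\ln(2)^2\|\mathbf{X}\|_{\cdot,2}^4\|\mathbf{X}\|_{\cdot,\infty}^2}{9n^2(\mathrm{DegNSEP}^* )^2\nu^*(H(\beta^* ))^2}\right\rceil,\qquad \tau_{\mathrm{fast}} := 1-\frac{\nu^*(H(\beta^* ))\,n}{\|\mathbf{X}\|_{\cdot,2}^2}.$$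 Then $\tau_{\mathrm{fast}}<\tau_{\mathrm{slow}}<1$, and for all $k\ge\check K$: (iii) $L_n(\beta^k)-L_n^* \le (L_n(\beta^{\check K})-L_n^* )\cdot(\tau_{\mathrm{fast}})^{k-\check K}$, and (iv) $\|\beta^k-\beta^*\| \le \frac{\|\mathbf{X}\|_{\cdot,2}}{\nu^*(H(\beta^* ))}\sqrt{\frac{2(L_n(\beta^{\check K})-L_n^* )}{n}}\cdot(\tau_{\mathrm{fast}})^{(k-\check K)/2}$.
   Context: Data: $\mathbf{x}_i\in\mathbb{R}^p$, $y_i\in\{-1,1\}$, $i=1,\ldots,n$; $\mathbf{X}\in\mathbb{R}^{n\times p}$ is the matrix whose $i$-th row is $\mathbf{x}_i$. The data is separable if there is $\beta$ with $y_i\beta^T\mathbf{x}_i>0$ for all $i$, and non-separable otherwise. $\|\cdot\|$ is a given (arbitrary) norm on $\mathbb{R}^p$ with dual norm $\|s\|_* := \max_{\|x\|\le1}s^Tx$, and $\|\mathbf{X}\|_{\cdot,q}:=\max_{\|\beta\|\le 1}\|\mathbf{X}\beta\|_q$. The logistic loss is $L_n(\beta):=\frac1n\sum_{i=1}^n\ln(1+\exp(-y_i\beta^T\mathbf{x}_i))$, $L_n^*:=\inf_\beta L_n(\beta)$, and $H(\beta)$ is the Hessian of $L_n$ at $\beta$. With $[t]^-:=\max\{-t,0\}$, $$\mathrm{DegNSEP}^* := \min_{\|\beta\|=1}\frac1n\sum_{i=1}^n[y_i\beta^T\mathbf{x}_i]^-.$$ When $\mathrm{DegNSEP}^*>0$,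 $L_n$ has a unique minimizer. For a symmetric positive semidefinite matrix $M\in\mathbb{R}^{p\times p}$, $\nu^*(M):=\min_{\|\beta\|=1}\beta^TM\beta$. Steepest descent in the norm $\|\cdot\|$ for a differentiable function $f$: given $x^0$, at each iteration $k\ge0$ choose $d^k\in\arg\max_d\{\nabla f(x^k)^Td:\|d\|\le1\}$ (any maximizer), and set $x^{k+1}:=x^k-\alpha_kd^k$ with $\alpha_k\ge0$. Here $f=L_n$ and the iterates are denoted $\beta^k$. *)

theory Defs
  imports "HOL-Analysis.Analysis"
begin

definition is_norm :: "('a::real_vector \<Rightarrow> real) \<Rightarrow> bool" where
  "is_norm N \<longleftrightarrow>
     (\<forall>x. 0 \<le> N x) \<and> (\<forall>x. N x = 0 \<longleftrightarrow> x = 0) \<and>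
     (\<forall>c x. N (c *\<^sub>R x) = \<bar>c\<bar> * N x) \<and> (\<forall>x y. N (x + y) \<le> N x + N y)"

text \<open>The maxima and minima over the unit ball and unit sphere of \<open>N\<close> are written as suprema
  and infima; for a norm \<open>N\<close> on a finite-dimensional space these sets are compact and nonempty,
  so the extrema are attained.\<close>

definition dual_norm :: "('a::real_inner \<Rightarrow> real) \<Rightarrow> 'a \<Rightarrow> real" where
  "dual_norm N s = (SUP x\<in>{x. N x \<le> 1}. s \<bullet> x)"

text \<open>With \<open>M = norm\<close> (Euclidean) and \<open>M = infnorm\<close> this is the operator norm of \<open>X\<close> from \<open>N\<close>
  to \<open>\<ell>\<^sub>2\<close> and to \<open>\<ell>\<^sub>\<infinity>\<close>, respectively.\<close>

definition op_norm ::
    "(real^'p \<Rightarrow> real) \<Rightarrow> (real^'n \<Rightarrow> real) \<Rightarrow> real^'p^'n \<Rightarrow> real" where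
  "op_norm N M X = (SUP \<beta>\<in>{\<beta>. N \<beta> \<le> 1}. M (X *v \<beta>))"

definition nu_star :: "(real^'p \<Rightarrow> real) \<Rightarrow> real^'p^'p \<Rightarrow> real" where
  "nu_star N A = (INF \<beta>\<in>{\<beta>. N \<beta> = 1}. \<beta> \<bullet> (A *v \<beta>))"

definition gradient :: "('a::real_inner \<Rightarrow> real) \<Rightarrow> 'a \<Rightarrow> 'a" where
  "gradient f x = (THE D. GDERIV f x :> D)"

definition hessian :: "(real^'p \<Rightarrow> real) \<Rightarrow> real^'p \<Rightarrow> real^'p^'p" where
  "hessian f x = jacobian (gradient f) (at x)"

text \<open>The row \<open>X $ i\<close> is the feature vector of observation \<open>i\<close>, with label \<open>y $ i\<close>;
  the sample size is \<open>CARD('n)\<close>.\<close>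

definition separable :: "real^'p^'n \<Rightarrow> real^'n \<Rightarrow> bool" where
  "separable X y \<longleftrightarrow> (\<exists>\<beta>. \<forall>i. y $ i * (\<beta> \<bullet> X $ i) > 0)"

definition logistic_loss :: "real^'p^'n \<Rightarrow> real^'n \<Rightarrow> real^'p \<Rightarrow> real" where
  "logistic_loss X y \<beta> =
     (1 / real CARD('n)) * (\<Sum>i\<in>UNIV. ln (1 + exp (- (y $ i * (\<beta> \<bullet> X $ i)))))"

definition logistic_opt :: "real^'p^'n \<Rightarrow> real^'n \<Rightarrow> real" where
  "logistic_opt X y = (INF \<beta>. logistic_loss X y \<beta>)"

definition neg_part :: "real \<Rightarrow> real" where
  "neg_part t = max (- t) 0"

definition deg_nsep :: "(real^'p \<Rightarrow> real) \<Rightarrow> real^'p^'n \<Rightarrow> real^'n \<Rightarrow> real" where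
  "deg_nsep N X y =
     (INF \<beta>\<in>{\<beta>. N \<beta> = 1}.
        (1 / real CARD('n)) * (\<Sum>i\<in>UNIV. neg_part (y $ i * (\<beta> \<bullet> X $ i))))"

definition steepest_descent ::
    "('a::real_inner \<Rightarrow> real) \<Rightarrow> ('a \<Rightarrow> real) \<Rightarrow> (nat \<Rightarrow> real) \<Rightarrow> (nat \<Rightarrow> 'a) \<Rightarrow> bool" where
  "steepest_descent N f \<alpha> x \<longleftrightarrow>
     (\<forall>k. 0 \<le> \<alpha> k \<and>
        (\<exists>d. is_arg_max (\<lambda>d. gradient f (x k) \<bullet> d) (\<lambda>d. N d \<le> 1) d \<and>
             x (Suc k) = x k - \<alpha> k *\<^sub>R d))"

end

theory Submission
  imports Defs "HOL-Analysis.Harmonic_Numbers"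
begin

text \<open>Two properties of \<open>\<phi> t = ln (1 + exp (- t))\<close> drive the proof. Since \<open>\<phi>'' \<le> 1/4\<close>, one step
  decreases \<open>L\<close> by at least \<open>2 n \<parallel>\<nabla>L\<parallel>\<^sub>*\<^sup>2 / X\<^sub>2\<^sup>2\<close>. In the other direction, \<open>\<bar>\<phi>'''\<bar> \<le> \<phi>''\<close>, so that
  with \<open>d = \<beta> - \<beta>\<^sub>s\<close> and \<open>R = X\<^sub>i * N d\<close> the gradient at \<open>\<beta>\<close> has dual norm at least
  \<open>\<nu> * N d * (1 - exp (- R)) / R\<close>. Combined with \<open>L \<beta> - L \<beta>\<^sub>s \<le> \<parallel>\<nabla>L\<parallel>\<^sub>* * N d\<close> this gives a
  Polyak-Lojasiewicz inequality, hence linear convergence. The bound \<open>D * N \<beta> \<le> L \<beta> \<le> ln 2\<close> on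
  the initial level set controls \<open>R\<close> and yields the slow rate; it also yields a sublinear rate
  \<open>O(1/k)\<close>, which after \<open>K\<close> steps makes \<open>R\<close> so small that the curvature factor
  \<open>(1 - exp (- R)) / R\<close> is at least \<open>1/2\<close>, and this is the fast rate.\<close>

section \<open>Norms on Euclidean space\<close>

lemma
  assumes "is_norm N"
  shows is_norm_nonneg: "0 \<le> N x"
    and is_norm_eq_0: "N x = 0 \<longleftrightarrow> x = 0"
    and is_norm_scaleR: "N (c *\<^sub>R x) = \<bar>c\<bar> * N x"
    and is_norm_triangle: "N (x + y) \<le> N x + N y"
  using assms unfolding is_norm_def by blast+

lemma is_norm_zero: "is_norm N \<Longrightarrow> N 0 = 0"
  by (simp add: is_norm_eq_0)

lemma is_norm_pos: "is_norm N \<Longrightarrow> x \<noteq> 0 \<Longrightarrow> 0 < N x"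
  using is_norm_nonneg[of N x] is_norm_eq_0[of N x] by linarith

lemma is_norm_diff_le:
  assumes "is_norm N"
  shows "N (x - y) \<le> N x + N y"
  using is_norm_triangle[OF assms, of x "- y"] is_norm_scaleR[OF assms, of "-1" y] by simp

lemma is_norm_norm: "is_norm norm"
  by (simp add: is_norm_def norm_triangle_ineq)

lemma is_norm_infnorm: "is_norm (infnorm :: 'a::euclidean_space \<Rightarrow> real)"
  by (simp add: is_norm_def infnorm_eq_0 infnorm_mul infnorm_triangle infnorm_pos_le)

text \<open>A norm is convex, and a finite convex function on an open subset of a Euclidean space is
  continuous.\<close>

lemma is_norm_continuous_on:
  fixes N :: "'a::euclidean_space \<Rightarrow> real"
  assumes "is_norm N"
  shows "continuous_on A N"
proof -
  have "convex_on UNIV N"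
    by (auto intro!: convex_onI order.trans[OF is_norm_triangle[OF assms]]
        simp: is_norm_scaleR[OF assms])
  then show ?thesis
    using convex_on_continuous[OF open_UNIV] continuous_on_subset by blast
qed

text \<open>The constant is the minimum of \<open>N\<close> on the Euclidean unit sphere. It is
  attained by compactness, and positive because the sphere avoids 0.\<close>

lemma is_norm_ge_norm:
  fixes N :: "'a::euclidean_space \<Rightarrow> real"
  assumes "is_norm N"
  obtains c where "0 < c" "\<And>x. c * norm x \<le> N x"
proof -
  have "compact (sphere (0::'a) 1)" "sphere (0::'a) 1 \<noteq> {}"
    using vector_choose_size[of 1] by auto
  then obtain z where z: "z \<in> sphere 0 1" "\<And>x. x \<in> sphere 0 1 \<Longrightarrow> N z \<le> N x"
    using continuous_attains_inf[OF _ _ is_norm_continuous_on[OF assms]] by metis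
  have "N z * norm x \<le> N x" for x
  proof (cases "x = 0")
    case False
    then have "N z \<le> N ((1 / norm x) *\<^sub>R x)"
      by (intro z) simp
    then show ?thesis
      using False by (simp add: is_norm_scaleR[OF assms] field_simps)
  qed (simp add: is_norm_zero[OF assms])
  moreover have "0 < N z"
    using z(1) by (intro is_norm_pos[OF assms]) auto
  ultimately show ?thesis
    using that by blast
qed

lemma is_norm_unit_vector:
  assumes "is_norm N" "x \<noteq> 0"
  shows "N ((1 / N x) *\<^sub>R x) = 1"
  using is_norm_pos[OF assms] by (simp add: is_norm_scaleR[OF assms(1)])

lemma is_norm_unit_exists:
  fixes N :: "'a::euclidean_space \<Rightarrow> real"
  assumes "is_norm N"
  obtains x where "N x = 1"
  using is_norm_unit_vector[OF assms] vector_choose_size[of 1]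
  by (metis norm_zero zero_neq_one zero_le_one)

text \<open>Common source of the bounds by \<open>dual_norm\<close> and \<open>op_norm\<close>. The
  linear bound on \<open>F\<close> makes the supremum finite; normalizing \<open>x\<close> does the
  rest.\<close>

lemma homogeneous_le_SUP_unit_ball:
  fixes N F :: "'a::euclidean_space \<Rightarrow> real"
  assumes N: "is_norm N"
    and hom: "\<And>c x. 0 \<le> c \<Longrightarrow> F (c *\<^sub>R x) = c * F x"
    and bound: "\<And>x. F x \<le> B * norm x"
  shows "F x \<le> (SUP x\<in>{x. N x \<le> 1}. F x) * N x"
proof -
  obtain c where c: "0 < c" "\<And>x. c * norm x \<le> N x"
    using is_norm_ge_norm[OF N] by blast
  have "F x \<le> \<bar>B\<bar> / c" if "N x \<le> 1" for x
  proof -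
    have "F x \<le> \<bar>B\<bar> * norm x"
      by (rule order.trans[OF bound]) (simp add: mult_right_mono)
    also have "\<dots> \<le> \<bar>B\<bar> * (1 / c)"
      using c(2)[of x] that c(1) by (intro mult_left_mono) (auto simp: field_simps)
    finally show ?thesis by simp
  qed
  then have bdd: "bdd_above (F ` {x. N x \<le> 1})"
    by (intro bdd_aboveI2) auto
  show ?thesis
  proof (cases "x = 0")
    case True
    then show ?thesis
      using hom[of 0 0] by (simp add: is_norm_zero[OF N])
  next
    case False
    have "F ((1 / N x) *\<^sub>R x) \<le> (SUP x\<in>{x. N x \<le> 1}. F x)"
      using is_norm_unit_vector[OF N False] by (intro cSUP_upper bdd) simp
    then show ?thesis
      using hom[of "1 / N x" x] is_norm_pos[OF N False] by (simp add: field_simps)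
  qed
qed

lemma inner_le_dual_norm:
  fixes N :: "'a::euclidean_space \<Rightarrow> real"
  assumes "is_norm N"
  shows "s \<bullet> x \<le> dual_norm N s * N x"
  unfolding dual_norm_def
  by (rule homogeneous_le_SUP_unit_ball[OF assms, where B = "norm s"])
    (auto simp: norm_cauchy_schwarz)

text \<open>Of the values of \<open>s\<close> at a unit vector and at its negative, one is
  nonnegative.\<close>

lemma dual_norm_nonneg:
  fixes N :: "'a::euclidean_space \<Rightarrow> real"
  assumes "is_norm N"
  shows "0 \<le> dual_norm N s"
proof -
  obtain x where "N x = 1"
    using is_norm_unit_exists[OF assms] by blast
  moreover have "N (- x) = N x"
    using is_norm_scaleR[OF assms, of "-1" x] by simp
  ultimately show ?thesis
    using inner_le_dual_norm[OF assms, of s x] inner_le_dual_norm[OF assms, of s "- x"] by simp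
qed

lemma dual_norm_eq_arg_max:
  fixes N :: "'a::euclidean_space \<Rightarrow> real"
  assumes "is_arg_max (\<lambda>d. s \<bullet> d) (\<lambda>d. N d \<le> 1) d"
  shows "s \<bullet> d = dual_norm N s"
  unfolding dual_norm_def
  using assms by (intro cSup_eq_maximum[symmetric]) (auto simp: is_arg_max_linorder)

lemma op_norm_bound:
  assumes N: "is_norm N" and M: "is_norm M" and le: "\<And>z. M z \<le> C * norm z"
  shows "M (X *v x) \<le> op_norm N M X * N x"
proof -
  obtain B where B: "\<And>x. norm (X *v x) \<le> norm x * B"
    using bounded_linear.bounded[OF matrix_vector_mul_bounded_linear[of X]] by blast
  have bound: "M (X *v x) \<le> (\<bar>C\<bar> * B) * norm x" for x
  proof -
    have "M (X *v x) \<le> \<bar>C\<bar> * norm (X *v x)"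
      by (rule order.trans[OF le]) (simp add: mult_right_mono)
    also have "\<dots> \<le> \<bar>C\<bar> * (norm x * B)"
      by (intro mult_left_mono B) auto
    finally show ?thesis
      by (simp add: mult_ac)
  qed
  show ?thesis
    unfolding op_norm_def
    by (rule homogeneous_le_SUP_unit_ball[OF N _ bound])
      (simp add: is_norm_scaleR[OF M] matrix_vector_mult_scaleR)
qed

lemmas op_norm_norm_bound = op_norm_bound[OF _ is_norm_norm, of _ 1, simplified]

lemma abs_inner_row_le_op_norm_infnorm:
  assumes "is_norm N"
  shows "\<bar>x \<bullet> X $ i\<bar> \<le> op_norm N infnorm X * N x"
proof -
  have "\<bar>x \<bullet> X $ i\<bar> \<le> infnorm (X *v x)"
    using component_le_infnorm_cart[of "X *v x" i]
    by (simp add: matrix_vector_mul_component inner_commute)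
  also have "\<dots> \<le> op_norm N infnorm X * N x"
    by (rule op_norm_bound[OF assms is_norm_infnorm, of 1]) (simp add: infnorm_le_norm)
  finally show ?thesis .
qed

section \<open>The scalar logistic function\<close>

definition logistic_fn :: "real \<Rightarrow> real" where
  "logistic_fn t = ln (1 + exp (- t))"

text \<open>The derivative of \<open>logistic_fn\<close>, that is, minus the sigmoid evaluated at
  \<open>- t\<close>.\<close>

definition logistic_slope :: "real \<Rightarrow> real" where
  "logistic_slope t = - 1 / (1 + exp t)"

definition logistic_curv :: "real \<Rightarrow> real" where
  "logistic_curv t = exp t / (1 + exp t)\<^sup>2"

lemma one_plus_exp_ne_0: "1 + exp t \<noteq> (0::real)" "exp t + 1 \<noteq> (0::real)"
  using exp_gt_zero[of t] by linarith+

lemma DERIV_logistic_fn: "(logistic_fn has_real_derivative logistic_slope t) (at t)"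
  unfolding logistic_fn_def logistic_slope_def
  by (rule derivative_eq_intros refl | simp add: add_pos_pos exp_minus divide_simps
      one_plus_exp_ne_0)+

lemma DERIV_logistic_slope: "(logistic_slope has_real_derivative logistic_curv t) (at t)"
  unfolding logistic_curv_def logistic_slope_def
  by (rule derivative_eq_intros refl | simp add: one_plus_exp_ne_0 power2_eq_square)+

lemma logistic_curv_pos: "0 < logistic_curv t"
  by (simp add: logistic_curv_def one_plus_exp_ne_0)

lemma logistic_curv_le: "logistic_curv t \<le> 1 / 4"
proof -
  have "4 * exp t \<le> (1 + exp t)\<^sup>2"
    using zero_le_power2[of "1 - exp t"] by (simp add: power2_eq_square algebra_simps)
  then show ?thesis
    by (simp add: logistic_curv_def divide_le_eq add_pos_pos)
qed

lemma logistic_fn_convex: "logistic_slope s * (t - s) \<le> logistic_fn t - logistic_fn s"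
  by (rule f''_imp_f'[OF convex_UNIV DERIV_logistic_fn DERIV_logistic_slope])
    (auto intro: less_imp_le logistic_curv_pos)

text \<open>The function \<open>t\<^sup>2 / 8 - logistic_fn t\<close> has second derivative
  \<open>1 / 4 - logistic_curv t\<close>, so it is convex and lies above its tangent at
  \<open>s\<close>.\<close>

lemma logistic_fn_smooth:
  "logistic_fn t \<le> logistic_fn s + logistic_slope s * (t - s) + (t - s)\<^sup>2 / 8"
proof -
  have "(s / 4 - logistic_slope s) * (t - s)
      \<le> (t\<^sup>2 / 8 - logistic_fn t) - (s\<^sup>2 / 8 - logistic_fn s)"
    by (rule f''_imp_f'[OF convex_UNIV, where f'' = "\<lambda>t. 1 / 4 - logistic_curv t"])
      (auto intro!: derivative_eq_intros DERIV_logistic_fn DERIV_logistic_slope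
        simp: logistic_curv_le[simplified])
  then show ?thesis
    by (simp add: power2_eq_square algebra_simps add_divide_distrib diff_divide_distrib)
qed

lemma logistic_fn_nonneg: "0 \<le> logistic_fn t"
  by (simp add: logistic_fn_def)

lemma logistic_fn_ge_neg_part: "neg_part t \<le> logistic_fn t"
proof -
  have "- t = ln (exp (- t))" by simp
  also have "\<dots> \<le> logistic_fn t"
    unfolding logistic_fn_def by (subst ln_le_cancel_iff) (auto simp: add_pos_pos)
  finally show ?thesis
    using logistic_fn_nonneg[of t] by (simp add: neg_part_def)
qed

text \<open>Integrated form of the self-concordance bound: moving right from \<open>u\<close>, the
  curvature shrinks at most like a decaying exponential. With \<open>a = exp u\<close> and
  \<open>b = exp v\<close> the claim reduces to \<open>1 + a * b \<le> (1 + a) * b\<close>.\<close>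

lemma logistic_slope_diff_ge:
  assumes "0 \<le> v"
  shows "logistic_curv u * (1 - exp (- v)) \<le> logistic_slope (u + v) - logistic_slope u"
proof -
  define a b where "a = exp u" and "b = exp v"
  have ab: "0 < a" "1 \<le> b"
    using assms by (auto simp: a_def b_def)
  then have p: "0 < 1 + a" "0 < 1 + a * b"
    by (auto intro: add_pos_pos)
  have "a / (1 + a)\<^sup>2 * (1 - 1 / b) = a * (b - 1) / ((1 + a) * ((1 + a) * b))"
    using ab p by (simp add: power2_eq_square field_simps)
  also have "\<dots> \<le> a * (b - 1) / ((1 + a) * (1 + a * b))"
    using ab p by (intro divide_left_mono mult_left_mono mult_pos_pos) (auto simp: algebra_simps)
  also have "\<dots> = - 1 / (1 + a * b) - - 1 / (1 + a)"
    using p by (simp add: divide_simps) (simp add: algebra_simps)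
  finally show ?thesis
    by (simp add: logistic_curv_def logistic_slope_def exp_add exp_minus inverse_eq_divide
        flip: a_def b_def)
qed

lemma logistic_slope_minus: "logistic_slope (- t) = - 1 - logistic_slope t"
  using one_plus_exp_ne_0(1)[of t] by (simp add: logistic_slope_def exp_minus divide_simps)

lemma logistic_curv_minus: "logistic_curv (- t) = logistic_curv t"
  using one_plus_exp_ne_0(1)[of t]
  by (simp add: logistic_curv_def exp_minus divide_simps) (simp add: power2_eq_square algebra_simps)

lemma logistic_slope_diff_mult_ge:
  "logistic_curv u * (\<bar>v\<bar> * (1 - exp (- \<bar>v\<bar>))) \<le> (logistic_slope (u + v) - logistic_slope u) * v"
proof (cases "0 \<le> v")
  case True
  then show ?thesis
    using mult_right_mono[OF logistic_slope_diff_ge[OF True, of u] True] by (simp add: mult_ac)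
next
  case False
  then have v: "0 \<le> - v" by simp
  \<comment> \<open>The curvature is even and the slope is odd up to a constant, so a negative
    increment from \<open>u\<close> becomes the positive increment \<open>- v\<close> from
    \<open>- u\<close>.\<close>
  have "logistic_slope (- u + - v) = - 1 - logistic_slope (u + v)"
    using logistic_slope_minus[of "u + v"] by simp
  then have "logistic_curv u * (1 - exp v) \<le> logistic_slope u - logistic_slope (u + v)"
    using logistic_slope_diff_ge[OF v, of "- u"]
    by (simp add: logistic_curv_minus logistic_slope_minus)
  from mult_right_mono[OF this v] show ?thesis
    using False by (simp add: algebra_simps)
qed

text \<open>By concavity \<open>1 - exp (- r)\<close> lies above its chord from 0 to
  \<open>R\<close>, so a constant \<open>c\<close> admissible at \<open>R\<close> serves every
  smaller radius. This lets one \<open>c\<close> handle all observations at once.\<close>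

lemma one_minus_exp_ge_chord:
  fixes r R c :: real
  assumes "0 \<le> r" "r \<le> R" "c * R \<le> 1 - exp (- R)"
  shows "c * r \<le> 1 - exp (- r)"
proof (cases "R = 0")
  case False
  with assms have R: "0 < R" by simp
  define t where "t = r / R"
  have t: "0 \<le> t" "t \<le> 1" and r: "r = t * R"
    using assms R by (auto simp: t_def)
  have "exp ((1 - t) *\<^sub>R 0 + t *\<^sub>R (- R)) \<le> (1 - t) * exp 0 + t * exp (- R)"
    by (rule convex_onD[OF exp_convex]) (use t in auto)
  then have "exp (- r) \<le> 1 - t * (1 - exp (- R))"
    by (simp add: r algebra_simps)
  moreover have "c * r \<le> t * (1 - exp (- R))"
    using mult_left_mono[OF assms(3) t(1)] by (simp add: r mult_ac)
  ultimately show ?thesis by linarith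
qed (use assms in auto)

text \<open>A rewriting of \<open>1 + R \<le> exp R\<close>. It supplies an admissible constant for
  any radius and is the origin of the denominator in the slow rate.\<close>

lemma divide_one_plus_le_one_minus_exp:
  fixes R :: real
  assumes "0 \<le> R"
  shows "1 / (1 + R) * R \<le> 1 - exp (- R)"
proof -
  have "exp (- R) \<le> 1 / (1 + R)"
    using exp_ge_add_one_self[of R] assms by (simp add: exp_minus divide_simps)
  also have "\<dots> = 1 - 1 / (1 + R) * R"
    using assms by (simp add: field_simps)
  finally show ?thesis by simp
qed

section \<open>The logistic loss\<close>

definition margin :: "real^'p^'n \<Rightarrow> real^'n \<Rightarrow> real^'p \<Rightarrow> 'n \<Rightarrow> real" where
  "margin X y b i = y $ i * (b \<bullet> X $ i)"

lemma margin_linear: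
  "margin X y (b + d) i = margin X y b i + margin X y d i"
  "margin X y (b - d) i = margin X y b i - margin X y d i"
  "margin X y (c *\<^sub>R b) i = c * margin X y b i"
  "margin X y (- b) i = - margin X y b i"
  by (simp_all add: margin_def algebra_simps)

lemma margin_has_derivative [derivative_intros]:
  "((\<lambda>b. margin X y b i) has_derivative (\<lambda>h. margin X y h i)) F"
  unfolding margin_def by (auto intro!: derivative_eq_intros)

lemma abs_margin:
  assumes "y $ i \<in> {-1, 1}"
  shows "\<bar>margin X y b i\<bar> = \<bar>b \<bullet> X $ i\<bar>"
  using assms by (auto simp: margin_def abs_mult)

lemma sum_margin_squared:
  assumes "\<And>i. y $ i \<in> {-1, 1}"
  shows "(\<Sum>i\<in>UNIV. (margin X y b i)\<^sup>2) = (norm (X *v b))\<^sup>2"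
proof -
  have "(margin X y b i)\<^sup>2 = ((X *v b) $ i)\<^sup>2" for i
    using arg_cong[OF abs_margin[OF assms[of i], of X b], of "\<lambda>t. t\<^sup>2"]
    by (simp add: matrix_vector_mul_component inner_commute)
  then show ?thesis
    by (simp add: norm_vec_def L2_set_def sum_nonneg)
qed

lemma logistic_loss_margin:
  fixes X :: "real^'p^'n"
  shows "logistic_loss X y b = (1 / real CARD('n)) * (\<Sum>i\<in>UNIV. logistic_fn (margin X y b i))"
  by (simp add: logistic_loss_def logistic_fn_def margin_def)

definition logistic_grad :: "real^'p^'n \<Rightarrow> real^'n \<Rightarrow> real^'p \<Rightarrow> real^'p" where
  "logistic_grad X y b =
     (1 / real CARD('n)) *\<^sub>R (\<Sum>i\<in>UNIV. (y $ i * logistic_slope (margin X y b i)) *\<^sub>R X $ i)"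

lemma logistic_grad_inner:
  fixes X :: "real^'p^'n"
  shows "logistic_grad X y b \<bullet> h =
    (1 / real CARD('n)) * (\<Sum>i\<in>UNIV. logistic_slope (margin X y b i) * margin X y h i)"
  by (simp add: logistic_grad_def inner_sum_left margin_def inner_commute[of h] mult_ac)

lemma logistic_loss_has_derivative:
  "(logistic_loss X y has_derivative (\<lambda>h. logistic_grad X y b \<bullet> h)) (at b)"
  unfolding logistic_loss_margin[abs_def] logistic_grad_inner
  by (auto intro!: derivative_eq_intros DERIV_compose_FDERIV[OF DERIV_logistic_fn])
    (auto simp: mult_ac)

lemma gradient_eqI:
  assumes "(f has_derivative (\<lambda>h. D \<bullet> h)) (at x)"
  shows "gradient f x = D"
  unfolding gradient_def
proof (rule the_equality)
  show "GDERIV f x :> D"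
    using assms by (simp add: gderiv_def inner_commute)
  fix D' assume "GDERIV f x :> D'"
  then have "(\<lambda>h. h \<bullet> D') = (\<lambda>h. D \<bullet> h)"
    using has_derivative_unique[OF _ assms] by (simp add: gderiv_def)
  then have "(D' - D) \<bullet> (D' - D) = 0"
    by (metis inner_commute inner_diff_right right_minus_eq)
  then show "D' = D" by simp
qed

lemma gradient_logistic_loss: "gradient (logistic_loss X y) = logistic_grad X y"
  by (rule ext gradient_eqI logistic_loss_has_derivative)+

text \<open>Pairing the derivative of the gradient with \<open>b\<close> turns the leftover label
  and row into a second margin factor. The quadratic form is thus a curvature-weighted mean of
  squared margins.\<close>

lemma hessian_logistic_loss:
  fixes X :: "real^'p^'n"
  assumes "\<And>i. y $ i \<in> {-1, 1}"
  shows "b \<bullet> (hessian (logistic_loss X y) b0 *v b) =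
    (1 / real CARD('n)) * (\<Sum>i\<in>UNIV. logistic_curv (margin X y b0 i) * (margin X y b i)\<^sup>2)"
proof -
  let ?H = "\<lambda>h. (1 / real CARD('n)) *\<^sub>R
    (\<Sum>i\<in>UNIV. (y $ i * (logistic_curv (margin X y b0 i) * margin X y h i)) *\<^sub>R X $ i)"
  have "(logistic_grad X y has_derivative ?H) (at b0)"
    unfolding logistic_grad_def[abs_def]
    by (auto intro!: derivative_eq_intros DERIV_compose_FDERIV[OF DERIV_logistic_slope])
      (auto simp: mult_ac)
  then have D: "?H = frechet_derivative (logistic_grad X y) (at b0)" and lin: "linear ?H"
    by (auto intro: frechet_derivative_at has_derivative_linear)
  have "hessian (logistic_loss X y) b0 *v b = ?H b"
    unfolding hessian_def gradient_logistic_loss jacobian_def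
    by (subst D[symmetric], subst matrix_works) (use lin in \<open>auto simp: linear_matrix_vector_mul_eq\<close>)
  also have "b \<bullet> \<dots> = (1 / real CARD('n)) *
      (\<Sum>i\<in>UNIV. logistic_curv (margin X y b0 i) * (margin X y b i)\<^sup>2)"
    by (simp add: inner_sum_right margin_def power2_eq_square mult_ac)
  finally show ?thesis .
qed

lemma logistic_loss_zero: "logistic_loss X y 0 = ln 2"
  by (simp add: logistic_loss_margin margin_def logistic_fn_def)

section \<open>Convexity, smoothness and gradient growth\<close>

lemma logistic_loss_convex:
  "logistic_loss X y b - logistic_loss X y b' \<le> logistic_grad X y b \<bullet> (b - b')"
proof -
  have "(\<Sum>i\<in>UNIV. logistic_fn (margin X y b i) - logistic_fn (margin X y b' i))
      \<le> (\<Sum>i\<in>UNIV. logistic_slope (margin X y b i) * margin X y (b - b') i)"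
    by (intro sum_mono)
      (use logistic_fn_convex in \<open>auto simp: margin_linear algebra_simps le_diff_eq\<close>)
  then show ?thesis
    by (simp add: logistic_loss_margin logistic_grad_inner sum_subtractf divide_right_mono
        flip: diff_divide_distrib)
qed

text \<open>The scalar quadratic bound summed over the observations; labels of modulus 1 disappear
  from the squared margins, leaving the Euclidean norm of \<open>X *v h\<close>.\<close>

lemma logistic_loss_smooth:
  fixes X :: "real^'p^'n"
  assumes "\<And>i. y $ i \<in> {-1, 1}"
  shows "logistic_loss X y (b + h) \<le>
    logistic_loss X y b + logistic_grad X y b \<bullet> h + (norm (X *v h))\<^sup>2 / (8 * real CARD('n))"
proof -
  let ?n = "real CARD('n)"
  have "(\<Sum>i\<in>UNIV. logistic_fn (margin X y (b + h) i))
      \<le> (\<Sum>i\<in>UNIV. logistic_fn (margin X y b i) +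
          logistic_slope (margin X y b i) * margin X y h i + (margin X y h i)\<^sup>2 / 8)"
  proof (intro sum_mono)
    fix i
    show "logistic_fn (margin X y (b + h) i) \<le> logistic_fn (margin X y b i) +
          logistic_slope (margin X y b i) * margin X y h i + (margin X y h i)\<^sup>2 / 8"
      using logistic_fn_smooth[of "margin X y (b + h) i" "margin X y b i"]
      by (simp add: margin_linear)
  qed
  then have "(1 / ?n) * (\<Sum>i\<in>UNIV. logistic_fn (margin X y (b + h) i))
      \<le> (1 / ?n) * (\<Sum>i\<in>UNIV. logistic_fn (margin X y b i) +
          logistic_slope (margin X y b i) * margin X y h i + (margin X y h i)\<^sup>2 / 8)"
    by (intro mult_left_mono) auto
  also have "\<dots> = logistic_loss X y b + logistic_grad X y b \<bullet> h + (norm (X *v h))\<^sup>2 / (8 * ?n)"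
    by (simp add: logistic_loss_margin logistic_grad_inner sum.distrib algebra_simps
        flip: sum_margin_squared[OF assms] sum_divide_distrib)
  finally show ?thesis
    by (simp add: logistic_loss_margin)
qed

text \<open>The quantity \<open>(1 - e\<^sup>-\<^sup>R) / R\<close> bounding \<open>c\<close> is the loss of curvature which a generalized
  self-concordant function can suffer over a distance along which the margins move by at most
  \<open>R\<close>.\<close>

lemma logistic_grad_diff_ge:
  fixes X :: "real^'p^'n"
  assumes labels: "\<And>i. y $ i \<in> {-1, 1}" and "is_norm N"
    and le: "op_norm N infnorm X * N d \<le> R"
    and c: "c * R \<le> 1 - exp (- R)"
  shows "c * (d \<bullet> (hessian (logistic_loss X y) b *v d))
    \<le> (logistic_grad X y (b + d) - logistic_grad X y b) \<bullet> d"
proof -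
  have "c * (logistic_curv (margin X y b i) * (margin X y d i)\<^sup>2)
      \<le> (logistic_slope (margin X y (b + d) i) - logistic_slope (margin X y b i)) * margin X y d i"
    for i
  proof -
    let ?u = "margin X y b i" and ?v = "margin X y d i"
    have "\<bar>?v\<bar> \<le> R"
      using abs_inner_row_le_op_norm_infnorm[OF assms(2), of d X i] le
      by (simp add: abs_margin[OF labels])
    then have "c * \<bar>?v\<bar> \<le> 1 - exp (- \<bar>?v\<bar>)"
      by (intro one_minus_exp_ge_chord[OF _ _ c]) auto
    then have "logistic_curv ?u * (\<bar>?v\<bar> * (c * \<bar>?v\<bar>)) \<le>
        logistic_curv ?u * (\<bar>?v\<bar> * (1 - exp (- \<bar>?v\<bar>)))"
      by (intro mult_left_mono less_imp_le[OF logistic_curv_pos]) auto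
    also have "\<dots> \<le> (logistic_slope (?u + ?v) - logistic_slope ?u) * ?v"
      by (rule logistic_slope_diff_mult_ge)
    also have "logistic_curv ?u * (\<bar>?v\<bar> * (c * \<bar>?v\<bar>)) = c * (logistic_curv ?u * (\<bar>?v\<bar> * \<bar>?v\<bar>))"
      by (simp only: mult_ac)
    finally show ?thesis
      by (simp add: margin_linear power2_eq_square)
  qed
  then have "(\<Sum>i\<in>UNIV. c * (logistic_curv (margin X y b i) * (margin X y d i)\<^sup>2))
    \<le> (\<Sum>i\<in>UNIV. (logistic_slope (margin X y (b + d) i) - logistic_slope (margin X y b i)) *
        margin X y d i)"
    by (intro sum_mono)
  then show ?thesis
    by (simp add: hessian_logistic_loss[OF labels] logistic_grad_inner inner_diff_left
        left_diff_distrib sum_subtractf divide_right_mono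
        flip: sum_distrib_left diff_divide_distrib)
qed

section \<open>Consequences of the degree of non-separability\<close>

lemma deg_nsep_le:
  fixes X :: "real^'p^'n"
  assumes N: "is_norm N"
  shows "deg_nsep N X y * N b \<le> (1 / real CARD('n)) * (\<Sum>i\<in>UNIV. neg_part (margin X y b i))"
proof (cases "b = 0")
  case True
  then show ?thesis
    by (simp add: is_norm_zero[OF N] margin_def neg_part_def)
next
  case False
  have pos: "0 < N b"
    by (rule is_norm_pos[OF N False])
  have "deg_nsep N X y \<le>
      (1 / real CARD('n)) * (\<Sum>i\<in>UNIV. neg_part (margin X y ((1 / N b) *\<^sub>R b) i))"
    unfolding deg_nsep_def margin_def
    by (rule cINF_lower) (auto intro!: bdd_belowI2[where m = 0] sum_nonneg divide_nonneg_nonneg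
        simp: is_norm_unit_vector[OF N False] neg_part_def simp del: inner_scaleR_left)
  also have "(\<lambda>i. neg_part (margin X y ((1 / N b) *\<^sub>R b) i)) =
      (\<lambda>i. (1 / N b) * neg_part (margin X y b i))"
    using pos by (auto simp: neg_part_def margin_linear max_def field_simps)
  finally show ?thesis
    using pos by (simp add: field_simps flip: sum_divide_distrib)
qed

text \<open>Linear growth of the loss: when the degree is positive, level sets are bounded. This
  confines both the minimizer and the iterates.\<close>

lemma logistic_loss_ge_deg_nsep:
  assumes "is_norm N"
  shows "deg_nsep N X y * N b \<le> logistic_loss X y b"
  unfolding logistic_loss_margin
  by (rule order.trans[OF deg_nsep_le[OF assms]])
    (intro mult_left_mono sum_mono logistic_fn_ge_neg_part, simp)

text \<open>The bound is applied to \<open>b\<close> and to \<open>- b\<close>; the two negative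
  parts add up to the absolute value, whence the factor 2.\<close>

lemma deg_nsep_le_mean_abs:
  fixes X :: "real^'p^'n"
  assumes N: "is_norm N"
  shows "2 * deg_nsep N X y * N b \<le> (1 / real CARD('n)) * (\<Sum>i\<in>UNIV. \<bar>margin X y b i\<bar>)"
proof -
  have "N (- b) = N b"
    using is_norm_scaleR[OF N, of "-1" b] by simp
  moreover have "neg_part t + neg_part (- t) = \<bar>t\<bar>" for t
    by (simp add: neg_part_def)
  ultimately show ?thesis
    using add_mono[OF deg_nsep_le[OF N, of X y b] deg_nsep_le[OF N, of X y "- b"]]
    by (simp add: margin_linear mult_ac flip: add_divide_distrib sum.distrib)
qed

lemma deg_nsep_le_op_norm:
  fixes X :: "real^'p^'n"
  assumes N: "is_norm N" and labels: "\<And>i. y $ i \<in> {-1, 1}"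
  shows "2 * deg_nsep N X y \<le> op_norm N infnorm X"
proof -
  obtain b where b: "N b = 1"
    using is_norm_unit_exists[OF N] by blast
  have "(\<Sum>i\<in>UNIV. \<bar>margin X y b i\<bar>) \<le> (\<Sum>i\<in>(UNIV::'n set). op_norm N infnorm X)"
    using abs_inner_row_le_op_norm_infnorm[OF N, of b X] b
    by (intro sum_mono) (simp add: abs_margin[OF labels])
  then have "(1 / real CARD('n)) * (\<Sum>i\<in>UNIV. \<bar>margin X y b i\<bar>) \<le> op_norm N infnorm X"
    by (simp add: divide_le_eq mult.commute)
  then show ?thesis
    using deg_nsep_le_mean_abs[OF N, where X = X and y = y and b = b] b by simp
qed

section \<open>Bounds on the smallest curvature\<close>

lemma nu_star_le:
  fixes X :: "real^'p^'n"
  assumes N: "is_norm N" and labels: "\<And>i. y $ i \<in> {-1, 1}"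
  shows "nu_star N (hessian (logistic_loss X y) b) * (N d)\<^sup>2
    \<le> d \<bullet> (hessian (logistic_loss X y) b *v d)"
proof (cases "d = 0")
  case True
  then show ?thesis
    by (simp add: is_norm_zero[OF N])
next
  case False
  let ?H = "hessian (logistic_loss X y) b" and ?e = "(1 / N d) *\<^sub>R d"
  have pos: "0 < N d"
    by (rule is_norm_pos[OF N False])
  have "nu_star N ?H \<le> ?e \<bullet> (?H *v ?e)"
    unfolding nu_star_def
    using is_norm_unit_vector[OF N False]
    by (intro cINF_lower bdd_belowI2[where m = 0])
      (auto simp: hessian_logistic_loss[OF labels] less_imp_le[OF logistic_curv_pos]
        intro!: sum_nonneg divide_nonneg_nonneg mult_nonneg_nonneg)
  then show ?thesis
    using pos by (simp add: matrix_vector_mult_scaleR power2_eq_square field_simps)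
qed

lemma nu_star_pos:
  fixes X :: "real^'p^'n"
  assumes N: "is_norm N" and labels: "\<And>i. y $ i \<in> {-1, 1}" and D: "0 < deg_nsep N X y"
  shows "0 < nu_star N (hessian (logistic_loss X y) b)"
proof -
  define m where "m = Min ((\<lambda>i. logistic_curv (margin X y b i)) ` UNIV)"
  have m_le: "m \<le> logistic_curv (margin X y b i)" for i
    by (simp add: m_def)
  have m: "0 < m"
    by (simp add: m_def logistic_curv_pos)
  \<comment> \<open>On the unit sphere the mean absolute margin is at least twice the degree, so the
    mean squared margin is at least the square of that, and each weight is at least
    \<open>m\<close>. A uniform bound is what survives the infimum.\<close>
  define e where "e = m * (2 * deg_nsep N X y)\<^sup>2"
  have "e \<le> d \<bullet> (hessian (logistic_loss X y) b *v d)" if d: "N d = 1" for d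
  proof -
    let ?n = "real CARD('n)"
    have "2 * deg_nsep N X y \<le> (1 / ?n) * (\<Sum>i\<in>UNIV. \<bar>margin X y d i\<bar>)"
      using deg_nsep_le_mean_abs[OF N, where X = X and y = y and b = d] d by simp
    then have "(2 * deg_nsep N X y)\<^sup>2 \<le> ((1 / ?n) * (\<Sum>i\<in>UNIV. \<bar>margin X y d i\<bar>))\<^sup>2"
      using D by (intro power_mono) auto
    also have "\<dots> = (1 / ?n)\<^sup>2 * (\<Sum>i\<in>UNIV. \<bar>margin X y d i\<bar>)\<^sup>2"
      by (simp only: power_mult_distrib)
    also have "\<dots> \<le> (1 / ?n)\<^sup>2 * ((\<Sum>i\<in>UNIV. \<bar>margin X y d i\<bar>\<^sup>2) * ?n)"
      by (intro mult_left_mono sum_squared_le_sum_of_squares) auto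
    also have "\<dots> = (1 / ?n) * (\<Sum>i\<in>UNIV. (margin X y d i)\<^sup>2)"
      by (simp add: power2_eq_square)
    finally have "e \<le> m * ((1 / ?n) * (\<Sum>i\<in>UNIV. (margin X y d i)\<^sup>2))"
      unfolding e_def using m by (intro mult_left_mono) auto
    also have "\<dots> = (1 / ?n) * (\<Sum>i\<in>UNIV. m * (margin X y d i)\<^sup>2)"
      by (simp add: sum_distrib_left)
    also have "\<dots> \<le> (1 / ?n) * (\<Sum>i\<in>UNIV. logistic_curv (margin X y b i) * (margin X y d i)\<^sup>2)"
      by (intro mult_left_mono sum_mono mult_right_mono m_le) auto
    finally show ?thesis
      by (simp add: hessian_logistic_loss[OF labels])
  qed
  moreover have "{d. N d = 1} \<noteq> {}"
    using is_norm_unit_exists[OF N] by blast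
  ultimately have "e \<le> nu_star N (hessian (logistic_loss X y) b)"
    unfolding nu_star_def by (intro cINF_greatest) auto
  moreover have "0 < e"
    using m D by (simp add: e_def)
  ultimately show ?thesis by linarith
qed

text \<open>Follows from the curvature bound 1/4. It later shows that \<open>X\<^sub>2\<close> is
  nonzero and that the fast rate is positive.\<close>

lemma nu_star_le_op_norm:
  fixes X :: "real^'p^'n"
  assumes N: "is_norm N" and labels: "\<And>i. y $ i \<in> {-1, 1}"
  shows "nu_star N (hessian (logistic_loss X y) b) \<le> (op_norm N norm X)\<^sup>2 / (4 * real CARD('n))"
proof -
  let ?n = "real CARD('n)"
  obtain d where d: "N d = 1"
    using is_norm_unit_exists[OF N] by blast
  have "nu_star N (hessian (logistic_loss X y) b) \<le> d \<bullet> (hessian (logistic_loss X y) b *v d)"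
    using nu_star_le[OF N labels, of X b d] d by simp
  also have "\<dots> \<le> (1 / ?n) * (\<Sum>i\<in>UNIV. 1 / 4 * (margin X y d i)\<^sup>2)"
    unfolding hessian_logistic_loss[OF labels]
    by (intro mult_left_mono sum_mono mult_right_mono logistic_curv_le) auto
  also have "\<dots> = (norm (X *v d))\<^sup>2 / (4 * ?n)"
    by (simp add: sum_divide_distrib[symmetric] sum_margin_squared[OF labels])
  also have "\<dots> \<le> (op_norm N norm X)\<^sup>2 / (4 * ?n)"
    using op_norm_norm_bound[OF N, of X d] d by (intro divide_right_mono power_mono) auto
  finally show ?thesis .
qed

section \<open>Existence and uniqueness of the minimizer\<close>

lemma logistic_loss_minimizer:
  fixes X :: "real^'p^'n"
  assumes N: "is_norm N" and D: "0 < deg_nsep N X y"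
  obtains b where "\<And>b'. logistic_loss X y b \<le> logistic_loss X y b'"
proof -
  \<comment> \<open>The level \<open>ln 2\<close> is the loss at 0, so this compact set is
    nonempty.\<close>
  let ?S = "{b. logistic_loss X y b \<le> ln 2}"
  have cont: "continuous_on A (logistic_loss X y)" for A
    using logistic_loss_has_derivative
    by (meson has_derivative_at_withinI has_derivative_continuous_on)
  obtain c where c: "0 < c" "\<And>x. c * norm x \<le> N x"
    using is_norm_ge_norm[OF N] by blast
  have "norm b \<le> ln 2 / (deg_nsep N X y * c)" if "b \<in> ?S" for b
  proof -
    have "deg_nsep N X y * (c * norm b) \<le> deg_nsep N X y * N b"
      using D c by (intro mult_left_mono) auto
    also have "\<dots> \<le> ln 2"
      using logistic_loss_ge_deg_nsep[OF N, of X y b] that by simp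
    finally show ?thesis
      using D c(1) by (simp add: field_simps)
  qed
  then have "compact ?S"
    using continuous_closed_vimage[of "{..ln 2}" "logistic_loss X y"] cont[of UNIV]
    by (auto simp: compact_eq_bounded_closed bounded_iff vimage_def continuous_on_eq_continuous_at)
  moreover have zero: "0 \<in> ?S"
    by (simp add: logistic_loss_zero)
  ultimately obtain b where b: "b \<in> ?S" "\<And>b'. b' \<in> ?S \<Longrightarrow> logistic_loss X y b \<le> logistic_loss X y b'"
    using continuous_attains_inf[OF _ _ cont, of ?S] by blast
  then have "logistic_loss X y b \<le> logistic_loss X y b'" for b'
    by (cases "b' \<in> ?S") auto
  then show thesis
    using that by blast
qed

lemma logistic_grad_minimizer:
  assumes "\<And>b'. logistic_loss X y b \<le> logistic_loss X y b'"
  shows "logistic_grad X y b = 0"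
proof -
  have "(\<lambda>h. logistic_grad X y b \<bullet> h) = (\<lambda>h. 0)"
    by (rule differential_zero_maxmin[OF _ open_UNIV logistic_loss_has_derivative])
      (use assms in auto)
  then show ?thesis
    by (metis inner_eq_zero_iff)
qed

text \<open>Strong monotonicity from the minimizer \<open>b\<close>, divided by the distance. Only
  the Hessian at \<open>b\<close> enters; \<open>c\<close> pays for the loss of curvature on the way
  to \<open>b'\<close>.\<close>

lemma dual_norm_logistic_grad_ge:
  fixes X :: "real^'p^'n"
  assumes N: "is_norm N" and labels: "\<And>i. y $ i \<in> {-1, 1}" and c0: "0 \<le> c"
    and opt: "logistic_grad X y b = 0"
    and le: "op_norm N infnorm X * N (b' - b) \<le> R"
    and c: "c * R \<le> 1 - exp (- R)"
  shows "c * nu_star N (hessian (logistic_loss X y) b) * N (b' - b)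
    \<le> dual_norm N (logistic_grad X y b')"
proof (cases "b' = b")
  case True
  then show ?thesis
    by (simp add: is_norm_zero[OF N] dual_norm_nonneg[OF N])
next
  case False
  let ?d = "b' - b"
  have pos: "0 < N ?d"
    using False by (intro is_norm_pos[OF N]) simp
  have "c * (nu_star N (hessian (logistic_loss X y) b) * (N ?d)\<^sup>2)
      \<le> c * (?d \<bullet> (hessian (logistic_loss X y) b *v ?d))"
    by (intro mult_left_mono nu_star_le[OF N labels] c0)
  also have "\<dots> \<le> logistic_grad X y b' \<bullet> ?d"
    using logistic_grad_diff_ge[OF labels N le c, of b] by (simp add: opt)
  also have "\<dots> \<le> dual_norm N (logistic_grad X y b') * N ?d"
    by (rule inner_le_dual_norm[OF N])
  finally show ?thesis
    using pos by (simp add: power2_eq_square flip: mult.assoc)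
qed

lemma logistic_loss_minimizer_unique:
  fixes X :: "real^'p^'n"
  assumes N: "is_norm N" and labels: "\<And>i. y $ i \<in> {-1, 1}" and D: "0 < deg_nsep N X y"
    and b: "\<And>z. logistic_loss X y b \<le> logistic_loss X y z"
    and b': "\<And>z. logistic_loss X y b' \<le> logistic_loss X y z"
  shows "b' = b"
proof -
  let ?R = "op_norm N infnorm X * N (b' - b)"
  have "0 \<le> op_norm N infnorm X"
    using deg_nsep_le_op_norm[OF N labels, of X] D by linarith
  then have R: "0 \<le> ?R"
    by (intro mult_nonneg_nonneg is_norm_nonneg[OF N])
  have "dual_norm N (logistic_grad X y b') = 0"
    using is_norm_zero[OF N]
    by (subst logistic_grad_minimizer[OF b'], unfold dual_norm_def inner_zero_left, subst cSUP_const)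
      (auto intro: exI[of _ 0])
  \<comment> \<open>However far apart the two minimizers are, \<open>1 / (1 + ?R)\<close> is a
    positive admissible constant, so a vanishing gradient at \<open>b'\<close> forces distance
    0.\<close>
  then have "1 / (1 + ?R) * nu_star N (hessian (logistic_loss X y) b) * N (b' - b) \<le> 0"
    using dual_norm_logistic_grad_ge[OF N labels _ logistic_grad_minimizer[OF b] order.refl
        divide_one_plus_le_one_minus_exp[OF R]] R
    by simp
  then have "N (b' - b) \<le> 0"
    using R nu_star_pos[OF N labels D, of b]
    by (simp add: mult_le_0_iff zero_less_mult_iff divide_le_0_iff)
  then show ?thesis
    using is_norm_nonneg[OF N, of "b' - b"] is_norm_eq_0[OF N, of "b' - b"] by simp
qed

section \<open>Steepest descent\<close>

text \<open>With \<open>N d \<le> 1\<close> the smoothness bound is a quadratic in the step size,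
  and the prescribed \<open>a\<close> is its minimizer.\<close>

lemma logistic_loss_steepest_step:
  fixes X :: "real^'p^'n"
  assumes N: "is_norm N" and labels: "\<And>i. y $ i \<in> {-1, 1}" and X2: "0 < op_norm N norm X"
    and d: "is_arg_max (\<lambda>d. logistic_grad X y b \<bullet> d) (\<lambda>d. N d \<le> 1) d"
    and a: "a = 4 * real CARD('n) * dual_norm N (logistic_grad X y b) / (op_norm N norm X)\<^sup>2"
  shows "logistic_loss X y (b - a *\<^sub>R d) \<le> logistic_loss X y b
    - 2 * real CARD('n) * (dual_norm N (logistic_grad X y b))\<^sup>2 / (op_norm N norm X)\<^sup>2"
proof -
  let ?n = "real CARD('n)" and ?X2 = "op_norm N norm X"
  let ?G = "dual_norm N (logistic_grad X y b)"
  have "N d \<le> 1"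
    using d by (simp add: is_arg_max_linorder)
  have G: "logistic_grad X y b \<bullet> d = ?G"
    by (rule dual_norm_eq_arg_max[OF d])
  have "0 \<le> a"
    unfolding a by (simp add: dual_norm_nonneg[OF N])
  have "N (- (a *\<^sub>R d)) \<le> a"
    using is_norm_scaleR[OF N, of "- a" d] \<open>0 \<le> a\<close> \<open>N d \<le> 1\<close> by (simp add: mult_left_le)
  then have "?X2 * N (- (a *\<^sub>R d)) \<le> ?X2 * a"
    using X2 by (intro mult_left_mono) auto
  then have "norm (X *v (- (a *\<^sub>R d))) \<le> ?X2 * a"
    by (rule order.trans[OF op_norm_norm_bound[OF N]])
  then have "(norm (X *v (- (a *\<^sub>R d))))\<^sup>2 \<le> (?X2 * a)\<^sup>2"
    by (intro power_mono) auto
  then have "(norm (X *v (- (a *\<^sub>R d))))\<^sup>2 / (8 * ?n) \<le> (?X2 * a)\<^sup>2 / (8 * ?n)"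
    by (intro divide_right_mono) auto
  also have "(?X2 * a)\<^sup>2 / (8 * ?n) = 2 * ?n * ?G\<^sup>2 / ?X2\<^sup>2"
    using X2 by (simp add: a power2_eq_square field_simps)
  finally have "logistic_loss X y (b - a *\<^sub>R d)
      \<le> logistic_loss X y b - a * ?G + 2 * ?n * ?G\<^sup>2 / ?X2\<^sup>2"
    using logistic_loss_smooth[OF labels, of X b "- (a *\<^sub>R d)"] G by simp
  also have "a * ?G = 4 * ?n * ?G\<^sup>2 / ?X2\<^sup>2"
    by (simp add: a power2_eq_square)
  finally show ?thesis by simp
qed

text \<open>Usually shown by noting that \<open>1 / \<delta> k\<close> grows by at least
  \<open>1 / C\<close> per step; this form avoids dividing by a possibly zero gap.\<close>

lemma quadratic_recursion_bound:
  fixes \<delta> :: "nat \<Rightarrow> real"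
  assumes C: "0 < C" and nonneg: "\<And>k. 0 \<le> \<delta> k"
    and rec: "\<And>k. \<delta> (Suc k) \<le> \<delta> k - (\<delta> k)\<^sup>2 / C"
  shows "real k * \<delta> k \<le> C"
proof (induction k)
  case (Suc k)
  let ?d = "\<delta> k"
  \<comment> \<open>Nonnegativity of the next term bounds the current one by \<open>C\<close>, so no
    assumption on the initial value is required.\<close>
  have "0 \<le> ?d * (C - ?d) / C"
    using order.trans[OF nonneg rec, of k] C by (simp add: power2_eq_square field_simps)
  then have "?d \<le> C"
    using C nonneg[of k] by (cases "?d = 0") (auto simp: zero_le_divide_iff zero_le_mult_iff)
  then have "0 \<le> (C - ?d) * (C - real k * ?d) + ?d\<^sup>2"
    using Suc by (intro add_nonneg_nonneg mult_nonneg_nonneg) auto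
  also have "\<dots> = C * (C - real (Suc k) * (?d - ?d\<^sup>2 / C))"
    using C by (simp add: power2_eq_square field_simps)
  finally have "real (Suc k) * (?d - ?d\<^sup>2 / C) \<le> C"
    using C by (simp add: zero_le_mult_iff)
  moreover have "real (Suc k) * \<delta> (Suc k) \<le> real (Suc k) * (?d - ?d\<^sup>2 / C)"
    by (intro mult_left_mono rec) simp
  ultimately show ?case by linarith
qed (use C in simp)

theorem theorem3p3:
  fixes N :: "real^'p \<Rightarrow> real" and X :: "real^'p^'n" and y :: "real^'n"
    and \<alpha> :: "nat \<Rightarrow> real" and \<beta> :: "nat \<Rightarrow> real^'p" and \<beta>\<^sub>s :: "real^'p"
    and D \<nu> X\<^sub>2 X\<^sub>i n \<tau>\<^sub>s\<^sub>l\<^sub>o\<^sub>w \<tau>\<^sub>f\<^sub>a\<^sub>s\<^sub>t Lopt :: real and L :: "real^'p \<Rightarrow> real" and K :: nat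
  assumes norm: "is_norm N"
    and labels: "\<And>i. y $ i \<in> {-1, 1}"
    and n_def: "n = real CARD('n)"
    and L_def: "L = logistic_loss X y"
    and Lopt_def: "Lopt = logistic_opt X y"
    and X2_def: "X\<^sub>2 = op_norm N norm X"
    and Xi_def: "X\<^sub>i = op_norm N infnorm X"
    and D_def: "D = deg_nsep N X y"
    and descent: "steepest_descent N L \<alpha> \<beta>"
    and init: "\<beta> 0 = 0"
    and step: "\<And>k. \<alpha> k = 4 * n * dual_norm N (gradient L (\<beta> k)) / X\<^sub>2\<^sup>2"
    and nonsep: "\<not> separable X y"
    and D_pos: "D > 0"
    and minimizer: "\<beta>\<^sub>s = (THE b. is_arg_min L (\<lambda>_. True) b)"
    and nu_def: "\<nu> = nu_star N (hessian L \<beta>\<^sub>s)"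
    and slow_def: "\<tau>\<^sub>s\<^sub>l\<^sub>o\<^sub>w = 1 - 2 * D * \<nu> * n / ((D + 2 * ln 2 * X\<^sub>i) * X\<^sub>2\<^sup>2)"
    and K_def: "K = nat \<lceil>16 * (ln 2)\<^sup>2 * X\<^sub>2 ^ 4 * X\<^sub>i\<^sup>2 / (9 * n\<^sup>2 * D\<^sup>2 * \<nu>\<^sup>2)\<rceil>"
    and fast_def: "\<tau>\<^sub>f\<^sub>a\<^sub>s\<^sub>t = 1 - \<nu> * n / X\<^sub>2\<^sup>2"
  shows "\<tau>\<^sub>s\<^sub>l\<^sub>o\<^sub>w < 1
    \<and> (\<forall>k. L (\<beta> k) - Lopt \<le> (ln 2 - Lopt) * \<tau>\<^sub>s\<^sub>l\<^sub>o\<^sub>w ^ k)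
    \<and> (\<forall>k. N (\<beta> k - \<beta>\<^sub>s) \<le> (1 + 2 * ln 2 * X\<^sub>i / D) * (X\<^sub>2 / \<nu>)
            * sqrt ((ln 2 - Lopt) / (2 * n)) * \<tau>\<^sub>s\<^sub>l\<^sub>o\<^sub>w powr (real k / 2))
    \<and> \<tau>\<^sub>f\<^sub>a\<^sub>s\<^sub>t < \<tau>\<^sub>s\<^sub>l\<^sub>o\<^sub>w
    \<and> (\<forall>k\<ge>K. L (\<beta> k) - Lopt \<le> (L (\<beta> K) - Lopt) * \<tau>\<^sub>f\<^sub>a\<^sub>s\<^sub>t ^ (k - K))
    \<and> (\<forall>k\<ge>K. N (\<beta> k - \<beta>\<^sub>s) \<le> (X\<^sub>2 / \<nu>)
            * sqrt (2 * (L (\<beta> K) - Lopt) / n) * \<tau>\<^sub>f\<^sub>a\<^sub>s\<^sub>t powr (real (k - K) / 2))"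
proof -

  \<comment> \<open>The minimizer and the quantities tracked along the iterates\<close>
  note defs = L_def X2_def Xi_def D_def n_def
  have D': "0 < deg_nsep N X y"
    using D_pos by (simp add: D_def)
  have n: "1 \<le> n"
    by (simp add: n_def Suc_le_eq)
  have grad: "gradient L = logistic_grad X y"
    by (simp add: L_def gradient_logistic_loss)

  obtain b where b: "\<And>z. L b \<le> L z"
    using logistic_loss_minimizer[OF norm D'] unfolding L_def by blast
  have "\<beta>\<^sub>s = b"
    unfolding minimizer
  proof (rule the_equality)
    show "is_arg_min L (\<lambda>_. True) b"
      using b by (simp add: is_arg_min_linorder)
    show "b' = b" if "is_arg_min L (\<lambda>_. True) b'" for b'
      using that b logistic_loss_minimizer_unique[OF norm labels D', of b b']
      unfolding L_def by (auto simp: is_arg_min_linorder)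
  qed
  with b have opt: "L \<beta>\<^sub>s \<le> L z" for z
    by simp
  have Lopt: "Lopt = L \<beta>\<^sub>s"
    unfolding Lopt_def logistic_opt_def L_def[symmetric]
    using opt by (intro cInf_eq_minimum) auto
  have grad_opt: "logistic_grad X y \<beta>\<^sub>s = 0"
    using logistic_grad_minimizer opt unfolding L_def by blast

  define G where "G k = dual_norm N (logistic_grad X y (\<beta> k))" for k
  define r where "r k = N (\<beta> k - \<beta>\<^sub>s)" for k
  define \<delta> where "\<delta> k = L (\<beta> k) - Lopt" for k
  have G: "0 \<le> G k" and r: "0 \<le> r k" and \<delta>: "0 \<le> \<delta> k" for k
    by (simp_all add: G_def dual_norm_nonneg norm r_def is_norm_nonneg \<delta>_def Lopt opt)

  have \<nu>: "0 < \<nu>" and \<nu>_le: "\<nu> \<le> X\<^sub>2\<^sup>2 / (4 * n)"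
    using nu_star_pos[OF norm labels D'] nu_star_le_op_norm[OF norm labels]
    by (simp_all add: nu_def defs)
  have X2: "0 < X\<^sub>2"
  proof -
    obtain x where "N x = 1"
      using is_norm_unit_exists[OF norm] by blast
    then have "0 \<le> X\<^sub>2"
      using op_norm_norm_bound[OF norm, of X x] unfolding X2_def
      by (auto intro: order.trans[OF norm_ge_zero])
    \<comment> \<open>Otherwise the upper bound on \<open>\<nu>\<close> would be 0, against its
      positivity.\<close>
    moreover have "X\<^sub>2 \<noteq> 0"
      using \<nu> \<nu>_le by auto
    ultimately show ?thesis by simp
  qed
  have Xi: "2 * D \<le> X\<^sub>i"
    using deg_nsep_le_op_norm[OF norm labels] by (simp add: defs)
  then have Xi_pos: "0 < X\<^sub>i"
    using D_pos by linarith
  have ln2: "2 / 3 \<le> ln (2::real)" "ln (2::real) \<le> 3 / 4"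
    using ln2_ge_two_thirds ln2_le_25_over_36 by auto

  \<comment> \<open>One-step estimates and the radius of the initial level set\<close>
  have decrease: "\<delta> (Suc k) \<le> \<delta> k - 2 * n * (G k)\<^sup>2 / X\<^sub>2\<^sup>2" for k
  proof -
    obtain d where d: "is_arg_max (\<lambda>d. logistic_grad X y (\<beta> k) \<bullet> d) (\<lambda>d. N d \<le> 1) d"
        "\<beta> (Suc k) = \<beta> k - \<alpha> k *\<^sub>R d"
      using descent unfolding steepest_descent_def grad by blast
    have "L (\<beta> (Suc k)) \<le> L (\<beta> k) - 2 * n * (G k)\<^sup>2 / X\<^sub>2\<^sup>2"
      using logistic_loss_steepest_step[OF norm labels _ d(1), of "\<alpha> k"] X2 step[of k]
      by (simp add: d(2) gradient_logistic_loss G_def defs)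
    then show ?thesis
      by (simp add: \<delta>_def)
  qed
  have gap: "\<delta> k \<le> G k * r k" for k
    using logistic_loss_convex[of X y "\<beta> k" \<beta>\<^sub>s]
      inner_le_dual_norm[OF norm, of "logistic_grad X y (\<beta> k)" "\<beta> k - \<beta>\<^sub>s"]
    by (simp add: \<delta>_def Lopt G_def r_def L_def)
  have grad_ge: "c * \<nu> * r k \<le> G k" if "0 \<le> c" "X\<^sub>i * r k \<le> R" "c * R \<le> 1 - exp (- R)" for c R k
    using dual_norm_logistic_grad_ge[OF norm labels that(1) grad_opt _ that(3), of "\<beta> k"] that(2)
    by (simp add: defs r_def G_def nu_def)

  have "L (\<beta> k) \<le> ln 2" for k
  proof (induction k)
    case (Suc k)
    have "0 \<le> 2 * n * (G k)\<^sup>2 / X\<^sub>2\<^sup>2"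
      using n by simp
    with Suc decrease[of k] show ?case
      by (simp add: \<delta>_def)
  qed (simp add: init L_def logistic_loss_zero)
  moreover have "L \<beta>\<^sub>s \<le> ln 2"
    using opt[of 0] by (simp add: L_def logistic_loss_zero)
  moreover have level: "N z \<le> ln 2 / D" if "L z \<le> ln 2" for z
    using logistic_loss_ge_deg_nsep[OF norm, of X y z] that D_pos
    by (simp add: L_def D_def field_simps)
  \<comment> \<open>Iterate and minimizer both lie in the level set, each within
    \<open>ln 2 / D\<close> of the origin; hence the factor 2 in \<open>r_le\<close>.\<close>
  ultimately have "N (\<beta> k) + N \<beta>\<^sub>s \<le> ln 2 / D + ln 2 / D" for k
    by (intro add_mono) blast+
  then have r_le: "r k \<le> 2 * ln 2 / D" for k
    using order.trans[OF is_norm_diff_le[OF norm]] by (simp add: r_def)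
  have \<delta>0: "\<delta> 0 = ln 2 - Lopt"
    by (simp add: \<delta>_def init L_def logistic_loss_zero)

  have grad_gap: "(G k)\<^sup>2 \<le> X\<^sub>2\<^sup>2 / (2 * n) * \<delta> k" for k
  proof -
    have "2 * n * (G k)\<^sup>2 / X\<^sub>2\<^sup>2 \<le> \<delta> k"
      using decrease[of k] \<delta>[of "Suc k"] by linarith
    then show ?thesis
      using n X2 by (simp add: field_simps)
  qed
  \<comment> \<open>Multiplying the gradient lower bound by \<open>G k\<close> and inserting
    \<open>gap\<close> gives \<open>c * \<nu> * \<delta> k \<le> (G k)\<^sup>2\<close>, the
    Polyak-Lojasiewicz inequality for this step.\<close>
  have contraction: "\<delta> (Suc k) \<le> \<delta> k * (1 - 2 * n * c * \<nu> / X\<^sub>2\<^sup>2)"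
    if "0 \<le> c" and c: "c * \<nu> * r k \<le> G k" for c k
  proof -
    have "c * \<nu> * \<delta> k \<le> c * \<nu> * (G k * r k)"
      using that(1) \<nu> by (intro mult_left_mono gap) auto
    also have "\<dots> \<le> (G k)\<^sup>2"
      using mult_left_mono[OF c G[of k]] by (simp add: power2_eq_square mult_ac)
    finally have "2 * n / X\<^sub>2\<^sup>2 * (c * \<nu> * \<delta> k) \<le> 2 * n / X\<^sub>2\<^sup>2 * (G k)\<^sup>2"
      using n by (intro mult_left_mono) auto
    then show ?thesis
      using decrease[of k] by (simp add: algebra_simps)
  qed
  \<comment> \<open>The distance is controlled by the gradient and the gradient by the gap, so a
    rate for the gap gives its square root for the distance. The exponent \<open>m\<close> is kept
    apart from \<open>k\<close> to cover a late start.\<close>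
  have dist_le: "r k \<le> (1 / c) * (X\<^sub>2 / \<nu>) * sqrt (E / (2 * n)) * q powr (real m / 2)"
    if c: "0 < c" "c * \<nu> * r k \<le> G k" and q: "0 < q" and le: "\<delta> k \<le> E * q ^ m"
    for c q E k m
  proof -
    have "(G k)\<^sup>2 \<le> X\<^sub>2\<^sup>2 / (2 * n) * (E * q ^ m)"
      using n by (intro order.trans[OF grad_gap] mult_left_mono le) auto
    then have "G k \<le> sqrt (X\<^sub>2\<^sup>2 / (2 * n) * (E * q ^ m))"
      by (rule real_le_rsqrt)
    also have "\<dots> = X\<^sub>2 * sqrt (E / (2 * n)) * sqrt (q ^ m)"
      using X2 by (simp add: real_sqrt_mult real_sqrt_divide)
    also have "sqrt (q ^ m) = q powr (real m / 2)"
      using q by (simp add: powr_powr flip: powr_half_sqrt powr_realpow)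
    finally have "c * \<nu> * r k \<le> X\<^sub>2 * sqrt (E / (2 * n)) * q powr (real m / 2)"
      using c(2) by linarith
    then show ?thesis
      using c(1) \<nu> by (simp add: field_simps)
  qed

  \<comment> \<open>The slow linear rate\<close>
  define R where "R = X\<^sub>i * (2 * ln 2 / D)"
  \<comment> \<open>\<open>R\<close> bounds the movement of the margins for every iterate, so this
    \<open>c\<close> is valid for all \<open>k\<close>.\<close>
  define c where "c = 1 / (1 + R)"
  have R: "0 < R"
    using Xi_pos D_pos by (simp add: R_def)
  have c: "0 < c" "c * \<nu> * r k \<le> G k" for k
  proof -
    show "0 < c"
      using R by (simp add: c_def)
    moreover have "X\<^sub>i * r k \<le> R"
      unfolding R_def using Xi_pos by (intro mult_left_mono r_le) auto
    moreover have "c * R \<le> 1 - exp (- R)"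
      unfolding c_def using R by (intro divide_one_plus_le_one_minus_exp) auto
    ultimately show "c * \<nu> * r k \<le> G k"
      by (intro grad_ge) auto
  qed
  have c_eq: "c = D / (D + 2 * ln 2 * X\<^sub>i)" and c_inv: "1 / c = 1 + 2 * ln 2 * X\<^sub>i / D"
    using D_pos by (simp_all add: c_def R_def field_simps)
  have slow: "\<tau>\<^sub>s\<^sub>l\<^sub>o\<^sub>w = 1 - 2 * n * c * \<nu> / X\<^sub>2\<^sup>2"
    by (simp add: slow_def c_eq mult_ac)
  \<comment> \<open>The fast rate is the contraction factor with constant 1/2, so comparing the
    rates means comparing \<open>c\<close> with 1/2.\<close>
  have "2 * c < 1"
  proof -
    have "2 / 3 * (4 * D) \<le> ln 2 * (2 * X\<^sub>i)"
      by (rule mult_mono) (use ln2(1) Xi D_pos in auto)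
    then show ?thesis
      using D_pos Xi_pos by (simp add: c_eq divide_less_eq add_pos_pos mult_ac)
  qed
  then have "n / X\<^sub>2\<^sup>2 * \<nu> * (2 * c) < n / X\<^sub>2\<^sup>2 * \<nu> * 1"
    using n X2 \<nu> by (intro mult_strict_left_mono) auto
  then have fast_slow: "\<tau>\<^sub>f\<^sub>a\<^sub>s\<^sub>t < \<tau>\<^sub>s\<^sub>l\<^sub>o\<^sub>w"
    by (simp add: slow fast_def mult_ac)
  have slow_1: "\<tau>\<^sub>s\<^sub>l\<^sub>o\<^sub>w < 1"
    using c(1) n X2 \<nu> by (simp add: slow)
  \<comment> \<open>Positivity of the rates is what the inductions and the \<open>powr\<close> form
    of the distance bounds rely on.\<close>
  have fast_pos: "0 < \<tau>\<^sub>f\<^sub>a\<^sub>s\<^sub>t"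
  proof -
    have "4 * (\<nu> * n) \<le> X\<^sub>2\<^sup>2"
      using \<nu>_le n by (simp add: field_simps)
    moreover have "0 < \<nu> * n" "0 < X\<^sub>2\<^sup>2"
      using \<nu> n X2 by simp_all
    ultimately have "\<nu> * n < X\<^sub>2\<^sup>2"
      by linarith
    then show ?thesis
      using X2 by (simp add: fast_def)
  qed
  with fast_slow have slow_pos: "0 < \<tau>\<^sub>s\<^sub>l\<^sub>o\<^sub>w" by linarith

  have i: "\<delta> k \<le> \<delta> 0 * \<tau>\<^sub>s\<^sub>l\<^sub>o\<^sub>w ^ k" for k
  proof (induction k)
    case (Suc k)
    have "\<delta> (Suc k) \<le> \<delta> k * \<tau>\<^sub>s\<^sub>l\<^sub>o\<^sub>w"
      using contraction[OF less_imp_le[OF c(1)] c(2)] by (simp add: slow)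
    also have "\<dots> \<le> \<delta> 0 * \<tau>\<^sub>s\<^sub>l\<^sub>o\<^sub>w ^ k * \<tau>\<^sub>s\<^sub>l\<^sub>o\<^sub>w"
      using slow_pos by (intro mult_right_mono Suc) auto
    finally show ?case by (simp add: mult_ac)
  qed simp
  have ii: "r k \<le> (1 + 2 * ln 2 * X\<^sub>i / D) * (X\<^sub>2 / \<nu>) * sqrt ((ln 2 - Lopt) / (2 * n))
      * \<tau>\<^sub>s\<^sub>l\<^sub>o\<^sub>w powr (real k / 2)" for k
    using dist_le[OF c(1) c(2) slow_pos i] unfolding c_inv \<delta>0 .

  \<comment> \<open>Sublinear decrease and the fast linear rate\<close>
  define C where "C = X\<^sub>2\<^sup>2 / (2 * n) * (2 * ln 2 / D)\<^sup>2"
  have "0 < C"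
    using X2 n D_pos by (simp add: C_def)
  have sublinear: "real k * \<delta> k \<le> C" for k
  proof (rule quadratic_recursion_bound[OF \<open>0 < C\<close> \<delta>])
    fix k
    \<comment> \<open>With the uniform radius in \<open>gap\<close>, the gradient term in
      \<open>decrease\<close> dominates the squared gap; \<open>C\<close> collects the
      constants.\<close>
    have "\<delta> k \<le> G k * (2 * ln 2 / D)"
      by (rule order.trans[OF gap]) (intro mult_left_mono r_le G)
    then have "(\<delta> k)\<^sup>2 \<le> (G k * (2 * ln 2 / D))\<^sup>2"
      by (intro power_mono \<delta>)
    then have "(\<delta> k)\<^sup>2 / C \<le> (G k * (2 * ln 2 / D))\<^sup>2 / C"
      using \<open>0 < C\<close> by (intro divide_right_mono) auto
    also have "\<dots> = 2 * n * (G k)\<^sup>2 / X\<^sub>2\<^sup>2"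
      using D_pos n X2 by (simp add: C_def power_mult_distrib power_divide field_simps)
    finally show "\<delta> (Suc k) \<le> \<delta> k - (\<delta> k)\<^sup>2 / C"
      using decrease[of k] by linarith
  qed

  text \<open>The threshold \<open>K\<close> is chosen so that the sublinear rate forces \<open>1 - exp (- \<rho>) \<le> 3 / 4\<close>
    for the margin radius \<open>\<rho>\<close>. Then \<open>\<rho> \<le> 2 * ln 2\<close>, where the curvature factor is still
    \<open>3 / (8 * ln 2) \<ge> 1 / 2\<close>.\<close>
  have grad_ge_fast: "1 / 2 * \<nu> * r k \<le> G k" if "K \<le> k" for k
  proof -
    define \<rho> where "\<rho> = X\<^sub>i * r k"
    let ?K = "16 * (ln 2)\<^sup>2 * X\<^sub>2 ^ 4 * X\<^sub>i\<^sup>2 / (9 * n\<^sup>2 * D\<^sup>2 * \<nu>\<^sup>2)"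
    have K_pos: "0 < ?K"
      using X2 Xi_pos n D_pos \<nu> by simp
    have K_le: "?K \<le> real k"
      using that unfolding K_def by linarith
    have "?K * (G k)\<^sup>2 \<le> real k * (X\<^sub>2\<^sup>2 / (2 * n) * \<delta> k)"
      using K_pos by (intro mult_mono K_le grad_gap) auto
    also have "\<dots> = X\<^sub>2\<^sup>2 / (2 * n) * (real k * \<delta> k)"
      by simp
    also have "\<dots> \<le> X\<^sub>2\<^sup>2 / (2 * n) * C"
      using n by (intro mult_left_mono sublinear) auto
    \<comment> \<open>This identity fixes the value of the threshold: the 16/9 in it is the inverse
      square of 3/4.\<close>
    also have "\<dots> = ?K * (3 / 4 * \<nu> / X\<^sub>i)\<^sup>2"
      using X2 n D_pos \<nu> Xi_pos
      by (simp add: C_def power_mult_distrib power_divide field_simps)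
        (simp add: power2_eq_square)
    finally have "(G k)\<^sup>2 \<le> (3 / 4 * \<nu> / X\<^sub>i)\<^sup>2"
      using K_pos by (simp only: mult_le_cancel_left_pos)
    then have "G k \<le> 3 / 4 * \<nu> / X\<^sub>i"
      by (rule power2_le_imp_le) (use \<nu> Xi_pos in auto)
    then have Xi_G: "X\<^sub>i * G k \<le> 3 / 4 * \<nu>"
      using Xi_pos by (simp add: field_simps)
    have "\<rho> \<le> 2 * ln 2"
    proof (cases "\<rho> = 0")
      case False
      then have \<rho>: "0 < \<rho>" and "0 < r k"
        using Xi_pos r[of k] unfolding \<rho>_def by (auto simp: less_le)
      have "(1 - exp (- \<rho>)) / \<rho> * \<nu> * r k \<le> G k"
        using \<rho> by (intro grad_ge[of _ _ \<rho>]) (auto simp: \<rho>_def)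
      \<comment> \<open>Since \<open>\<rho>\<close> is proportional to \<open>r k\<close>, the
        distance cancels, and the small gradient limits \<open>1 - exp (- \<rho>)\<close>
        itself.\<close>
      moreover have "e / \<rho> * \<nu> * r k = e * \<nu> / X\<^sub>i" for e
        using Xi_pos \<open>0 < r k\<close> by (simp add: \<rho>_def)
      ultimately have "(1 - exp (- \<rho>)) * \<nu> / X\<^sub>i \<le> G k"
        by (simp only:)
      then have "(1 - exp (- \<rho>)) * \<nu> \<le> X\<^sub>i * G k"
        using Xi_pos by (simp add: divide_le_eq mult.commute)
      with Xi_G have "(1 - exp (- \<rho>)) * \<nu> \<le> 3 / 4 * \<nu>"
        by linarith
      then have "1 - exp (- \<rho>) \<le> 3 / 4"
        using \<nu> by (simp only: mult_le_cancel_right_pos)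
      then have "exp \<rho> \<le> 4"
        by (simp add: exp_minus field_simps)
      then have "\<rho> \<le> ln 4"
        by (simp add: ln_ge_iff)
      then show ?thesis
        using ln_realpow[of 2 2] by simp
    qed simp
    moreover have "exp (- (2 * ln 2)) = (1 / 4 :: real)"
      by (simp add: exp_minus exp_double power2_eq_square)
    ultimately show ?thesis
      using ln2(2) by (intro grad_ge[of _ _ "2 * ln 2"]) (auto simp: \<rho>_def)
  qed
  have iii: "\<delta> k \<le> \<delta> K * \<tau>\<^sub>f\<^sub>a\<^sub>s\<^sub>t ^ (k - K)" if "K \<le> k" for k
    using that
  proof (induction k rule: dec_induct)
    case (step k)
    have "\<delta> (Suc k) \<le> \<delta> k * \<tau>\<^sub>f\<^sub>a\<^sub>s\<^sub>t"
      using contraction[OF _ grad_ge_fast[OF step(1)]] by (simp add: fast_def mult_ac)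
    also have "\<dots> \<le> \<delta> K * \<tau>\<^sub>f\<^sub>a\<^sub>s\<^sub>t ^ (k - K) * \<tau>\<^sub>f\<^sub>a\<^sub>s\<^sub>t"
      using fast_pos by (intro mult_right_mono step) auto
    finally show ?case
      using step(1) by (simp add: Suc_diff_le mult_ac)
  qed simp
  have iv: "r k \<le> X\<^sub>2 / \<nu> * sqrt (2 * \<delta> K / n) * \<tau>\<^sub>f\<^sub>a\<^sub>s\<^sub>t powr (real (k - K) / 2)" if "K \<le> k" for k
  proof -
    \<comment> \<open>The factor \<open>1 / c = 2\<close> from \<open>dist_le\<close> is absorbed
      into the square root.\<close>
    have "2 * \<delta> K / n = 2\<^sup>2 * (\<delta> K / (2 * n))"
      by simp
    then have "sqrt (2 * \<delta> K / n) = 2 * sqrt (\<delta> K / (2 * n))"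
      by (simp only: real_sqrt_mult real_sqrt_abs)
    then show ?thesis
      using dist_le[OF _ grad_ge_fast[OF that] fast_pos iii[OF that]] by (simp add: mult_ac)
  qed
  show ?thesis
    by (intro conjI allI impI slow_1 fast_slow i[unfolded \<delta>0, unfolded \<delta>_def] ii[unfolded r_def]
        iii[unfolded \<delta>_def] iv[unfolded r_def \<delta>_def])
qed

end
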